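(* A two-level quantum system used in an $n$-to-1 parity-oblivious multiplexing task can achieve maximal advantage over classical systems only if $n<4$. That is, let $n\ge 1$ be an integer and suppose there is a quantum realisation of an $n$-to-1 parity-oblivious multiplexing scenario on the Hilbert space $\mathcal{H}=\mathbb{C}^2$ whose success rate $s$ attains the optimal quantum value $s=\frac12\left(1+\frac{1}{\sqrt n}\right)$. Then $n<4$.
   Context: A quantum realisation of an $n$-to-1 parity-oblivious multiplexing (POM) scenario on a finite-dimensional Hilbert space $\mathcal{H}$ consists of a density operator $\rho_x$ on $\mathcal{H}$ for each bitstring $x=(x_1,\dots,x_n)\in X_n:=\{0,1\}^n$ (the preparation $P_x$ encoding $x$), and, for each $y\in\{1,\dots,n\}$, a two-outcome POVM $M_y=\{E_{0|M_y},E_{1|M_y}\}$ on $\mathcal{H}$ (so $E_{k|M_y}\ge 0$ and $E_{0|M_y}+E_{1|M_y}=\mathbb{1}$). The statistics are $p(k|M_y,P_x)=\mathrm{Tr}(E_{k|M_y}\rho_x)$. They are required to satisfy parity-obliviousness: for every $t\in\{0,1\}^n$ with $\sum_i t_i\ge 2$, every $y$ and every $k\in\{0,1\}$, $$\sum_{x:\,x\cdot t=0}p(k|M_y,P_x)=\sum_{x:\,x\cdot t=1}p(k|M_y,P_x),$$ where $x\cdot t=\sum_i x_it_i$ modulo 2. The success rate of the scenario is $$s=\frac{1}{2^n n}\sum_{y=1}^n\sum_{x\in X_n}p(k=x_y|M_y,P_x).$$ The optimal success rate over noncontextual (classical) realisations is $\frac12\left(1+\frac1n\right)$, and the optimal success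 rate over quantum realisations (of any dimension) is $\frac12\left(1+\frac1{\sqrt n}\right)$; "maximal advantage" means attaining the latter value. *)

theory Defs
  imports "HOL-Analysis.Analysis"
begin

text \<open>
  Operators on the Hilbert space \<open>\<complex>\<^sup>d\<close> (with its standard inner product) are matrices
  \<open>complex^'d^'d\<close>, with \<open>d = CARD('d)\<close>.
\<close>

definition matrix_adjoint :: "complex^'n^'m \<Rightarrow> complex^'m^'n" where
  "matrix_adjoint A = (\<chi> i j. cnj (A $ j $ i))"

definition quad_form :: "complex^'d^'d \<Rightarrow> complex^'d \<Rightarrow> complex" where
  "quad_form A v = (\<Sum>i\<in>UNIV. cnj (v $ i) * (A *v v) $ i)"

text \<open>
  By self-adjointness the quadratic form is real, so that only its real part has to be constrained.
\<close>

definition positive_op :: "complex^'d^'d \<Rightarrow> bool" where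
  "positive_op A \<longleftrightarrow> matrix_adjoint A = A \<and> (\<forall>v. 0 \<le> Re (quad_form A v))"

definition density_operator :: "complex^'d^'d \<Rightarrow> bool" where
  "density_operator \<rho> \<longleftrightarrow> positive_op \<rho> \<and> trace \<rho> = 1"

text \<open>Only the outcomes \<open>k = 0\<close> and \<open>k = 1\<close> are meaningful; other values of \<open>M\<close> are ignored.\<close>

definition two_outcome_povm :: "(nat \<Rightarrow> complex^'d^'d) \<Rightarrow> bool" where
  "two_outcome_povm M \<longleftrightarrow> positive_op (M 0) \<and> positive_op (M 1) \<and> M 0 + M 1 = mat 1"

text \<open>
  The Born rule. For self-adjoint arguments the trace is real (lemma \<open>trace_mult_self_adjoint_real\<close>
  below), so taking the real part only changes the type.
\<close>

definition outcome_prob :: "complex^'d^'d \<Rightarrow> complex^'d^'d \<Rightarrow> real" where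
  "outcome_prob E \<rho> = Re (trace (E ** \<rho>))"

lemma trace_mult_self_adjoint_real:
  fixes A B :: "complex^'d^'d"
  assumes "matrix_adjoint A = A" and "matrix_adjoint B = B"
  shows "trace (A ** B) \<in> \<real>"
proof -
  have A: "cnj (A $ i $ j) = A $ j $ i" for i j
    by (subst (2) assms(1)[symmetric]) (simp add: matrix_adjoint_def)
  have B: "cnj (B $ i $ j) = B $ j $ i" for i j
    by (subst (2) assms(2)[symmetric]) (simp add: matrix_adjoint_def)
  have "cnj (trace (A ** B)) = (\<Sum>i\<in>UNIV. \<Sum>j\<in>UNIV. A $ j $ i * B $ i $ j)"
    by (simp add: trace_def matrix_matrix_mult_def A B)
  also have "\<dots> = trace (A ** B)"
    by (subst sum.swap) (simp add: trace_def matrix_matrix_mult_def)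
  finally show ?thesis
    by (simp add: Reals_cnj_iff)
qed

text \<open>
  \<open>{0,1}\<^sup>n\<close>, with positions indexed by \<open>1,\<dots>,n\<close>. Outside these positions the functions are
  \<open>undefined\<close>, so that each bitstring is represented exactly once.
\<close>

definition bitstrings :: "nat \<Rightarrow> (nat \<Rightarrow> nat) set" where
  "bitstrings n = {1..n} \<rightarrow>\<^sub>E {0, 1}"

definition bit_dot :: "nat \<Rightarrow> (nat \<Rightarrow> nat) \<Rightarrow> (nat \<Rightarrow> nat) \<Rightarrow> nat" where
  "bit_dot n x t = (\<Sum>i = 1..n. x i * t i) mod 2"

text \<open>
  In the following, \<open>\<rho> x\<close> is the preparation \<open>P\<^sub>x\<close>, and \<open>E y k\<close> is the effect of outcome \<open>k\<close> of the
  measurement \<open>M\<^sub>y\<close>.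
\<close>

definition parity_oblivious ::
  "nat \<Rightarrow> ((nat \<Rightarrow> nat) \<Rightarrow> complex^'d^'d) \<Rightarrow> (nat \<Rightarrow> nat \<Rightarrow> complex^'d^'d) \<Rightarrow> bool" where
  "parity_oblivious n \<rho> E \<longleftrightarrow>
     (\<forall>t\<in>bitstrings n. 2 \<le> (\<Sum>i = 1..n. t i) \<longrightarrow>
       (\<forall>y\<in>{1..n}. \<forall>k\<in>{0, 1}.
          (\<Sum>x | x \<in> bitstrings n \<and> bit_dot n x t = 0. outcome_prob (E y k) (\<rho> x)) =
          (\<Sum>x | x \<in> bitstrings n \<and> bit_dot n x t = 1. outcome_prob (E y k) (\<rho> x))))"

definition pom_realisation ::
  "nat \<Rightarrow> ((nat \<Rightarrow> nat) \<Rightarrow> complex^'d^'d) \<Rightarrow> (nat \<Rightarrow> nat \<Rightarrow> complex^'d^'d) \<Rightarrow> bool" where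
  "pom_realisation n \<rho> E \<longleftrightarrow>
     (\<forall>x\<in>bitstrings n. density_operator (\<rho> x)) \<and>
     (\<forall>y\<in>{1..n}. two_outcome_povm (E y)) \<and>
     parity_oblivious n \<rho> E"

definition success_rate ::
  "nat \<Rightarrow> ((nat \<Rightarrow> nat) \<Rightarrow> complex^'d^'d) \<Rightarrow> (nat \<Rightarrow> nat \<Rightarrow> complex^'d^'d) \<Rightarrow> real" where
  "success_rate n \<rho> E =
     1 / (2 ^ n * real n) * (\<Sum>y = 1..n. \<Sum>x\<in>bitstrings n. outcome_prob (E y (x y)) (\<rho> x))"

end

theory Submission
  imports Defs
begin

text \<open>
  In Bloch coordinates, \<open>r\<^sub>x\<close> for the state \<open>\<rho>\<^sub>x\<close> and \<open>b\<^sub>y\<close> for the effect \<open>E y 0\<close> (all of norm at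
  most \<open>1\<close>), the success rate is an affine function of \<open>\<Sum>\<^sub>x V\<^sub>x \<bullet> r\<^sub>x\<close>, where
  \<open>V\<^sub>x = \<Sum>\<^sub>y (-1)\<^bsup>x\<^sub>y\<^esup> b\<^sub>y\<close>. The mean of \<open>\<parallel>V\<^sub>x\<parallel>\<^sup>2\<close> over \<open>x\<close> is \<open>\<Sum>\<^sub>y \<parallel>b\<^sub>y\<parallel>\<^sup>2 \<le> n\<close>, so attaining the
  optimal value is the equality case of Cauchy-Schwarz: \<open>\<parallel>V\<^sub>x\<parallel>\<^sup>2 = n\<close> for every \<open>x\<close> and
  \<open>\<parallel>b\<^sub>y\<parallel> = 1\<close>. As \<open>\<parallel>V\<^sub>x\<parallel>\<close> does not depend on the signs, the \<open>b\<^sub>y\<close> are pairwise orthogonal, and the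
  Bloch space \<open>\<real>\<^sup>3\<close> has room for at most three of them.
\<close>

section \<open>Sums over bitstrings\<close>

lemma finite_bitstrings: "finite (bitstrings n)"
  unfolding bitstrings_def by (intro finite_PiE) auto

lemma card_bitstrings: "card (bitstrings n) = 2 ^ n"
  unfolding bitstrings_def by (simp add: card_PiE flip: numeral_2_eq_2)

lemma bitstrings_nonempty: "bitstrings n \<noteq> {}"
  using card_bitstrings[of n] by fastforce

text \<open>Truncated subtraction swaps 0 and 1 but sends larger values to 0, so this is an
  involution only where position \<open>y\<close> holds a bit.\<close>

definition flip :: "nat \<Rightarrow> (nat \<Rightarrow> nat) \<Rightarrow> nat \<Rightarrow> nat" where
  "flip y x = x(y := 1 - x y)"

lemma bitstrings_bit: "x \<in> bitstrings n \<Longrightarrow> y \<in> {1..n} \<Longrightarrow> x y = 0 \<or> x y = 1"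
  unfolding bitstrings_def by (drule (1) PiE_mem) simp

lemma flip_in_bitstrings:
  assumes "x \<in> bitstrings n" "y \<in> {1..n}"
  shows "flip y x \<in> bitstrings n"
  using assms bitstrings_bit[OF assms]
  unfolding bitstrings_def flip_def by (auto simp: PiE_iff extensional_def)

lemma flip_flip:
  assumes "x \<in> bitstrings n" "y \<in> {1..n}"
  shows "flip y (flip y x) = x"
  using bitstrings_bit[OF assms] by (auto simp: flip_def fun_eq_iff)

lemma sign_flip:
  assumes "x \<in> bitstrings n" "y \<in> {1..n}"
  shows "(-1::real) ^ flip y x z = (if z = y then - ((-1) ^ x z) else (-1) ^ x z)"
  using bitstrings_bit[OF assms] by (auto simp: flip_def)

text \<open>Reindexing along the involution \<open>flip y\<close> turns the sum into its own
  negative.\<close>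

lemma sum_bitstrings_odd:
  fixes g :: "(nat \<Rightarrow> nat) \<Rightarrow> real"
  assumes y: "y \<in> {1..n}" and odd: "\<And>x. x \<in> bitstrings n \<Longrightarrow> g (flip y x) = - g x"
  shows "sum g (bitstrings n) = 0"
proof -
  have "sum g (bitstrings n) = (\<Sum>x\<in>bitstrings n. - g x)"
    by (rule sum.reindex_bij_witness[where i = "flip y" and j = "flip y"])
      (auto simp: flip_in_bitstrings[OF _ y] flip_flip[OF _ y] odd)
  then show ?thesis
    by (simp add: sum_negf)
qed

lemma sum_sign:
  assumes "y \<in> {1..n}"
  shows "(\<Sum>x\<in>bitstrings n. (-1::real) ^ x y) = 0"
  using assms by (intro sum_bitstrings_odd) (auto simp: sign_flip)

lemma sum_sign_sign:
  assumes "y \<in> {1..n}"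
  shows "(\<Sum>x\<in>bitstrings n. (-1::real) ^ x y * (-1) ^ x z) = (if y = z then 2 ^ n else 0)"
proof (cases "y = z")
  case True
  then show ?thesis
    by (simp add: card_bitstrings flip: power_mult_distrib)
next
  case False
  have "(\<Sum>x\<in>bitstrings n. (-1::real) ^ x y * (-1) ^ x z) = 0"
    using assms False by (intro sum_bitstrings_odd[OF assms]) (auto simp: sign_flip)
  with False show ?thesis
    by simp
qed

section \<open>Signed sums of vectors\<close>

definition signed_sum :: "nat \<Rightarrow> (nat \<Rightarrow> 'a::real_vector) \<Rightarrow> (nat \<Rightarrow> nat) \<Rightarrow> 'a" where
  "signed_sum n b x = (\<Sum>y = 1..n. (-1) ^ x y *\<^sub>R b y)"

lemma signed_sum_flip:
  assumes "x \<in> bitstrings n" "y \<in> {1..n}"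
  shows "signed_sum n b (flip y x) = signed_sum n b x - (2 * (-1) ^ x y) *\<^sub>R b y"
proof -
  have "signed_sum n b (flip y x) =
      (- ((-1) ^ x y)) *\<^sub>R b y + (\<Sum>z\<in>{1..n} - {y}. (-1) ^ x z *\<^sub>R b z)"
    unfolding signed_sum_def using assms
    by (subst sum.remove[of _ y]) (auto simp: sign_flip intro!: sum.cong)
  moreover have "signed_sum n b x =
      (-1) ^ x y *\<^sub>R b y + (\<Sum>z\<in>{1..n} - {y}. (-1) ^ x z *\<^sub>R b z)"
    unfolding signed_sum_def using assms by (subst sum.remove[of _ y]) auto
  moreover have "(2 * (-1) ^ x y) *\<^sub>R b y = (-1) ^ x y *\<^sub>R b y + (-1) ^ x y *\<^sub>R b y"
    by (simp only: mult_2 distrib_right scaleR_add_left)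
  ultimately show ?thesis
    by simp
qed

text \<open>In the expanded square each \<open>b y \<bullet> b z\<close> has a product of two signs
  as coefficient; summed over \<open>x\<close>, these products vanish off the diagonal.\<close>

lemma sum_norm_signed_sum:
  fixes b :: "nat \<Rightarrow> 'a::real_inner"
  shows "(\<Sum>x\<in>bitstrings n. (norm (signed_sum n b x))\<^sup>2) = 2 ^ n * (\<Sum>y = 1..n. (norm (b y))\<^sup>2)"
proof -
  have "(\<Sum>x\<in>bitstrings n. (norm (signed_sum n b x))\<^sup>2) =
      (\<Sum>x\<in>bitstrings n. \<Sum>y = 1..n. \<Sum>z = 1..n. ((-1) ^ x y * (-1) ^ x z) * (b y \<bullet> b z))"
    unfolding power2_norm_eq_inner signed_sum_def inner_sum_left
    unfolding inner_sum_right by (simp add: mult_ac)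
  also have "\<dots> = (\<Sum>y = 1..n. \<Sum>z = 1..n.
      (\<Sum>x\<in>bitstrings n. (-1) ^ x y * (-1) ^ x z) * (b y \<bullet> b z))"
    by (subst sum.swap, rule sum.cong[OF refl], subst sum.swap) (simp add: sum_distrib_right)
  also have "\<dots> = (\<Sum>y = 1..n. \<Sum>z = 1..n. (if y = z then 2 ^ n else 0) * (b y \<bullet> b z))"
    by (intro sum.cong refl) (simp add: sum_sign_sign)
  also have "\<dots> = (\<Sum>y = 1..n. 2 ^ n * (b y \<bullet> b y))"
    by (intro sum.cong refl) (simp add: mult_delta_left)
  finally show ?thesis
    by (simp add: power2_norm_eq_inner sum_distrib_left)
qed

lemma signed_sum_norm_const_orthogonal:
  fixes b :: "nat \<Rightarrow> 'a::real_inner"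
  assumes const: "\<And>x. x \<in> bitstrings n \<Longrightarrow> norm (signed_sum n b x) = c"
    and "y \<in> {1..n}" "z \<in> {1..n}" "y \<noteq> z"
  shows "b y \<bullet> b z = 0"
proof -
  let ?V = "signed_sum n b"
  \<comment> \<open>Flipping \<open>y\<close> shows that the right-hand side below does not change when \<open>z\<close> is flipped.\<close>
  have *: "b y \<bullet> b y = (-1) ^ x y * (b y \<bullet> ?V x)" if "x \<in> bitstrings n" for x
  proof -
    define s :: real where "s = (-1) ^ x y"
    have s: "s * s = 1"
      unfolding s_def by (simp flip: power_mult_distrib)
    have "?V (flip y x) \<bullet> ?V (flip y x) =
        ?V x \<bullet> ?V x - 4 * (s * (b y \<bullet> ?V x)) + 4 * ((s * s) * (b y \<bullet> b y))"
      by (simp add: signed_sum_flip[OF that assms(2)] inner_diff_left inner_diff_right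
          inner_commute algebra_simps flip: s_def)
    moreover have "?V (flip y x) \<bullet> ?V (flip y x) = ?V x \<bullet> ?V x"
      using const[OF that] const[OF flip_in_bitstrings[OF that assms(2)]]
      by (simp flip: power2_norm_eq_inner)
    ultimately show ?thesis
      unfolding s by (simp add: s_def)
  qed
  obtain x where x: "x \<in> bitstrings n"
    using bitstrings_nonempty by blast
  \<comment> \<open>Both sides equal \<open>b y \<bullet> b y\<close>. As
    \<open>y \<noteq> z\<close>, flipping \<open>z\<close> keeps the sign at \<open>y\<close> and
    only removes twice the \<open>z\<close>-term from \<open>?V x\<close>; that term must therefore
    be orthogonal to \<open>b y\<close>.\<close>
  have "(-1) ^ x y * (b y \<bullet> ?V x) = (-1) ^ flip z x y * (b y \<bullet> ?V (flip z x))"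
    using *[OF x] *[OF flip_in_bitstrings[OF x assms(3)]] by simp
  also have "\<dots> = (-1) ^ x y * (b y \<bullet> ?V x) - 2 * (-1) ^ x y * (-1) ^ x z * (b y \<bullet> b z)"
    using assms(4)
    by (simp add: sign_flip[OF x assms(3)] signed_sum_flip[OF x assms(3)] inner_diff_right
        algebra_simps)
  finally show ?thesis
    by simp
qed

lemma maximal_signed_correlation_dim:
  fixes b :: "nat \<Rightarrow> 'a::euclidean_space"
  assumes b: "\<And>y. y \<in> {1..n} \<Longrightarrow> norm (b y) \<le> 1"
    and r: "\<And>x. x \<in> bitstrings n \<Longrightarrow> norm (r x) \<le> 1"
    and max: "(\<Sum>x\<in>bitstrings n. signed_sum n b x \<bullet> r x) = 2 ^ n * sqrt n"
  shows "n \<le> DIM('a)"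
proof -
  let ?V = "signed_sum n b"
  let ?B = "bitstrings n"
  have b2: "(norm (b y))\<^sup>2 \<le> 1" if "y \<in> {1..n}" for y
    using b[OF that] by (simp add: power_le_one)
  have r2: "(norm (r x))\<^sup>2 \<le> 1" if "x \<in> ?B" for x
    using r[OF that] by (simp add: power_le_one)
  have sb: "(\<Sum>y = 1..n. (norm (b y))\<^sup>2) \<le> n"
    using sum_mono[of "{1..n}" "\<lambda>y. (norm (b y))\<^sup>2" "\<lambda>_. 1"] b2 by simp
  have sr: "(\<Sum>x\<in>?B. (norm (r x))\<^sup>2) \<le> 2 ^ n"
    using sum_mono[of ?B "\<lambda>x. (norm (r x))\<^sup>2" "\<lambda>_. 1"] r2 by (simp add: card_bitstrings)
  have V2: "(\<Sum>x\<in>?B. (norm (?V x))\<^sup>2) \<le> 2 ^ n * real n"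
    using sb by (simp add: sum_norm_signed_sum)
  \<comment> \<open>The Cauchy-Schwarz defect is written as a squared distance:
    \<open>sqrt n *\<^sub>R r x\<close> is the value that \<open>?V x\<close> takes in the equality
    case.\<close>
  have "(norm (?V x - sqrt n *\<^sub>R r x))\<^sup>2 =
      (norm (?V x))\<^sup>2 - 2 * sqrt n * (?V x \<bullet> r x) + n * (norm (r x))\<^sup>2" for x
    by (simp add: power2_norm_eq_inner inner_diff_left inner_diff_right inner_commute
        algebra_simps flip: real_sqrt_mult)
  then have D: "(\<Sum>x\<in>?B. (norm (?V x - sqrt n *\<^sub>R r x))\<^sup>2) =
      (\<Sum>x\<in>?B. (norm (?V x))\<^sup>2) - 2 * sqrt n * (2 ^ n * sqrt n) + n * (\<Sum>x\<in>?B. (norm (r x))\<^sup>2)"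
    by (simp add: sum.distrib sum_subtractf max flip: sum_distrib_left)
  have sq: "2 * sqrt n * (2 ^ n * sqrt n) = 2 * (2 ^ n * real n)"
    by simp
  have nr: "n * (\<Sum>x\<in>?B. (norm (r x))\<^sup>2) \<le> 2 ^ n * real n"
    using mult_left_mono[OF sr, of "real n"] by (simp add: mult.commute)
  have nonneg: "0 \<le> (\<Sum>x\<in>?B. (norm (?V x - sqrt n *\<^sub>R r x))\<^sup>2)"
    by (intro sum_nonneg) simp
  \<comment> \<open>With N = \<open>2 ^ n * real n\<close>, the right side of \<open>D\<close> is at
    most N - 2N + N = 0. Hence both estimates of the outer terms are equalities as well.\<close>
  have "(\<Sum>x\<in>?B. (norm (?V x - sqrt n *\<^sub>R r x))\<^sup>2) = 0"
    using D V2 nr nonneg unfolding sq by linarith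
  then have Vr: "?V x = sqrt n *\<^sub>R r x" if "x \<in> ?B" for x
    using that by (subst (asm) sum_nonneg_eq_0_iff) (auto simp: finite_bitstrings)
  have V2_eq: "(\<Sum>x\<in>?B. (norm (?V x))\<^sup>2) = 2 ^ n * real n"
    using D V2 nr nonneg unfolding sq by linarith
  have Vn: "(norm (?V x))\<^sup>2 \<le> n" if "x \<in> ?B" for x
    using mult_left_mono[OF r2[OF that], of "real n"] by (simp add: Vr that power_mult_distrib)
  \<comment> \<open>The mean of the squared norms equals their common upper bound \<open>n\<close>,
    so each of them does.\<close>
  have "(\<Sum>x\<in>?B. n - (norm (?V x))\<^sup>2) = 0"
    by (simp add: sum_subtractf V2_eq card_bitstrings)
  then have "norm (?V x) = sqrt n" if "x \<in> ?B" for x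
    using that Vn
    by (subst (asm) sum_nonneg_eq_0_iff) (auto simp: finite_bitstrings real_sqrt_unique)
  then have orth: "b y \<bullet> b z = 0" if "y \<in> {1..n}" "z \<in> {1..n}" "y \<noteq> z" for y z
    using signed_sum_norm_const_orthogonal that by blast
  have "(\<Sum>y = 1..n. 1 - (norm (b y))\<^sup>2) = 0"
    using V2_eq by (simp add: sum_subtractf sum_norm_signed_sum)
  then have "\<forall>y\<in>{1..n}. 1 - (norm (b y))\<^sup>2 = 0"
    using b2 sum_nonneg_eq_0_iff[of "{1..n}" "\<lambda>y. 1 - (norm (b y))\<^sup>2"]
    by (simp del: atLeastAtMost_iff)
  then have nz: "b y \<noteq> 0" if "y \<in> {1..n}" for y
    using that by force
  \<comment> \<open>Injectivity is what gives the orthogonal set its full \<open>n\<close>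
    elements.\<close>
  have "inj_on b {1..n}"
    using orth nz by (metis inj_onI inner_eq_zero_iff)
  moreover have "independent (b ` {1..n})"
  proof (rule pairwise_orthogonal_independent)
    show "pairwise orthogonal (b ` {1..n})"
      unfolding pairwise_def orthogonal_def using orth by blast
    show "0 \<notin> b ` {1..n}"
      using nz by (metis imageE)
  qed
  ultimately show ?thesis
    using independent_card_le[of "b ` {1..n}"] by (simp add: card_image)
qed

section \<open>The Bloch representation of a qubit\<close>

text \<open>For self-adjoint \<open>A\<close> these are the traces of \<open>A\<close> times the
  Pauli matrices Z, X and -Y. The order and the sign affect neither norms nor inner products. A
  density operator gets its usual Bloch vector.\<close>

definition bloch :: "complex^2^2 \<Rightarrow> real^3" where
  "bloch A = vector [Re (A $ 1 $ 1) - Re (A $ 2 $ 2), 2 * Re (A $ 1 $ 2), 2 * Im (A $ 1 $ 2)]"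

lemma self_adjoint_2_entries:
  fixes A :: "complex^2^2"
  assumes "matrix_adjoint A = A"
  shows "Im (A $ 1 $ 1) = 0" "Im (A $ 2 $ 2) = 0" "A $ 2 $ 1 = cnj (A $ 1 $ 2)"
proof -
  have "cnj (A $ i $ j) = A $ j $ i" for i j
    by (subst (2) assms[symmetric]) (simp add: matrix_adjoint_def)
  then show "Im (A $ 1 $ 1) = 0" "Im (A $ 2 $ 2) = 0" "A $ 2 $ 1 = cnj (A $ 1 $ 2)"
    by (metis Reals_cnj_iff complex_is_Real_iff)+
qed

text \<open>The identity and the Pauli matrices are orthogonal for the trace form, each with square
  2.\<close>

lemma outcome_prob_bloch:
  fixes A B :: "complex^2^2"
  assumes "matrix_adjoint A = A" "matrix_adjoint B = B"
  shows "outcome_prob A B = (Re (trace A) * Re (trace B) + bloch A \<bullet> bloch B) / 2"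
  using self_adjoint_2_entries[OF assms(1)] self_adjoint_2_entries[OF assms(2)]
  unfolding outcome_prob_def bloch_def
  by (simp add: trace_def matrix_matrix_mult_def sum_2 inner_vec_def sum_3 vector_3 field_simps)

lemma Re_quad_form_2:
  fixes A :: "complex^2^2"
  assumes "matrix_adjoint A = A"
  shows "Re (quad_form A v) = Re (A $ 1 $ 1) * (cmod (v $ 1))\<^sup>2 + Re (A $ 2 $ 2) * (cmod (v $ 2))\<^sup>2
    + 2 * Re (cnj (v $ 1) * A $ 1 $ 2 * v $ 2)"
  using self_adjoint_2_entries[OF assms] unfolding cmod_power2
  by (simp add: quad_form_def matrix_vector_mult_def sum_2 power2_eq_square algebra_simps)

text \<open>The squared norm is the squared trace minus four times the determinant, and positivity
  makes the determinant \<open>p * q - k\<close> nonnegative.\<close>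

lemma norm_bloch_le_trace:
  fixes A :: "complex^2^2"
  assumes "positive_op A"
  shows "norm (bloch A) \<le> Re (trace A)"
proof -
  have sa: "matrix_adjoint A = A" and pos: "\<And>v. 0 \<le> Re (quad_form A v)"
    using assms by (auto simp: positive_op_def)
  define p q c k where "p = Re (A $ 1 $ 1)" and "q = Re (A $ 2 $ 2)" and "c = A $ 1 $ 2"
    and "k = (cmod c)\<^sup>2"
  have Q: "0 \<le> p * (cmod u)\<^sup>2 + q * (cmod w)\<^sup>2 + 2 * Re (cnj u * c * w)" for u w
    using pos[of "vector [u, w]"] by (simp add: Re_quad_form_2[OF sa] p_def q_def c_def)
  note Q' = Q[unfolded cmod_power2]
  have p: "0 \<le> p" and q: "0 \<le> q"
    using Q[of 1 0] Q[of 0 1] by simp_all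
  have k: "k = Re c * Re c + Im c * Im c" "0 \<le> k"
    by (simp_all add: k_def cmod_power2 flip: power2_eq_square)
  \<comment> \<open>Here and in \<open>2\<close> the test vector is, up to sign, a column of the
    adjugate, which \<open>A\<close> maps to a multiple of a basis vector by the determinant, up to
    sign.\<close>
  have 1: "0 \<le> p * (p * q - k)"
    using Q'[of c "- of_real p"] by (simp add: k power2_eq_square algebra_simps)
  have 2: "0 \<le> q * (p * q - k)"
    using Q'[of "of_real q" "- cnj c"] by (simp add: k power2_eq_square algebra_simps)
  \<comment> \<open>This settles the case \<open>p = q = 0\<close>, where \<open>1\<close> and
    \<open>2\<close> are void: it leaves \<open>k \<le> 0\<close>.\<close>
  have 3: "0 \<le> p * k + q - 2 * k"
    using Q'[of c "- 1"] by (simp add: k power2_eq_square algebra_simps)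
  have "k \<le> p * q"
  proof (rule ccontr)
    assume "\<not> k \<le> p * q"
    then have "p = 0" "q = 0"
      using 1 2 p q mult_pos_neg[of p "p * q - k"] mult_pos_neg[of q "p * q - k"] by linarith+
    with 3 \<open>\<not> k \<le> p * q\<close> show False
      by simp
  qed
  then have "(norm (bloch A))\<^sup>2 \<le> (p + q)\<^sup>2"
    unfolding power2_norm_eq_inner
    by (simp add: bloch_def inner_vec_def sum_3 vector_3 k power2_eq_square algebra_simps
        flip: p_def q_def c_def)
  then have "norm (bloch A) \<le> p + q"
    by (rule power2_le_imp_le) (use p q in simp)
  then show ?thesis
    by (simp add: trace_def sum_2 p_def q_def)
qed

lemma two_outcome_povm_bloch:
  fixes M :: "nat \<Rightarrow> complex^2^2"
  assumes "two_outcome_povm M"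
  shows "Re (trace (M 1)) = 2 - Re (trace (M 0))" "bloch (M 1) = - bloch (M 0)"
    "norm (bloch (M 0)) \<le> 1"
proof -
  have pos: "positive_op (M 0)" "positive_op (M 1)" and M1: "M 1 = mat 1 - M 0"
    using assms by (auto simp: two_outcome_povm_def algebra_simps)
  show tr: "Re (trace (M 1)) = 2 - Re (trace (M 0))"
    by (simp only: M1) (simp add: trace_def sum_2 mat_def)
  show bl: "bloch (M 1) = - bloch (M 0)"
    by (simp only: M1) (simp add: bloch_def vec_eq_iff forall_3 vector_3 mat_def)
  \<comment> \<open>The two effects have Bloch vectors of equal norm and traces adding up to 2, so
    the smaller trace is at most 1.\<close>
  show "norm (bloch (M 0)) \<le> 1"
    using norm_bloch_le_trace[OF pos(1)] norm_bloch_le_trace[OF pos(2)] tr bl by simp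
qed

lemma success_rate_bloch:
  fixes \<rho> :: "(nat \<Rightarrow> nat) \<Rightarrow> complex^2^2"
  assumes n: "n \<ge> 1"
    and \<rho>: "\<And>x. x \<in> bitstrings n \<Longrightarrow> density_operator (\<rho> x)"
    and E: "\<And>y. y \<in> {1..n} \<Longrightarrow> two_outcome_povm (E y)"
  shows "success_rate n \<rho> E = 1 / 2 * (1 + 1 / (2 ^ n * n) *
    (\<Sum>x\<in>bitstrings n. signed_sum n (\<lambda>y. bloch (E y 0)) x \<bullet> bloch (\<rho> x)))"
proof -
  \<comment> \<open>This is the bias of the measurement, independent of the state. It enters with
    the sign \<open>(-1) ^ x y\<close> and so cancels in the sum over \<open>x\<close>.\<close>
  define a where "a y = Re (trace (E y 0)) - 1" for y
  define b where "b y = bloch (E y 0)" for y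
  have prob: "outcome_prob (E y (x y)) (\<rho> x) =
      (1 + (-1) ^ x y * a y + ((-1) ^ x y *\<^sub>R b y) \<bullet> bloch (\<rho> x)) / 2"
    if x: "x \<in> bitstrings n" and y: "y \<in> {1..n}" for x y
  proof -
    have sa: "matrix_adjoint (E y 0) = E y 0" "matrix_adjoint (E y 1) = E y 1"
      "matrix_adjoint (\<rho> x) = \<rho> x" and tr: "trace (\<rho> x) = 1"
      using \<rho>[OF x] E[OF y]
      by (auto simp: density_operator_def two_outcome_povm_def positive_op_def)
    from bitstrings_bit[OF x y] show ?thesis
      using two_outcome_povm_bloch(1,2)[OF E[OF y]]
      by (auto simp: outcome_prob_bloch sa sa[unfolded One_nat_def] tr a_def b_def)
  qed
  have "(\<Sum>y = 1..n. \<Sum>x\<in>bitstrings n. outcome_prob (E y (x y)) (\<rho> x)) =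
      (\<Sum>y = 1..n. \<Sum>x\<in>bitstrings n.
        (1 + (-1) ^ x y * a y + ((-1) ^ x y *\<^sub>R b y) \<bullet> bloch (\<rho> x)) / 2)"
    by (intro sum.cong refl prob)
  also have "\<dots> = (\<Sum>y = 1..n. (2 ^ n + (\<Sum>x\<in>bitstrings n. (-1) ^ x y) * a y +
      (\<Sum>x\<in>bitstrings n. ((-1) ^ x y *\<^sub>R b y) \<bullet> bloch (\<rho> x))) / 2)"
    by (simp add: sum.distrib card_bitstrings sum_distrib_right flip: sum_divide_distrib)
  also have "\<dots> = (\<Sum>y = 1..n. (2 ^ n +
      (\<Sum>x\<in>bitstrings n. ((-1) ^ x y *\<^sub>R b y) \<bullet> bloch (\<rho> x))) / 2)"
    by (intro sum.cong refl) (simp add: sum_sign)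
  also have "\<dots> = (2 ^ n * n +
      (\<Sum>y = 1..n. \<Sum>x\<in>bitstrings n. ((-1) ^ x y *\<^sub>R b y) \<bullet> bloch (\<rho> x))) / 2"
    by (simp add: sum.distrib flip: sum_divide_distrib)
  also have "(\<Sum>y = 1..n. \<Sum>x\<in>bitstrings n. ((-1) ^ x y *\<^sub>R b y) \<bullet> bloch (\<rho> x)) =
      (\<Sum>x\<in>bitstrings n. signed_sum n b x \<bullet> bloch (\<rho> x))"
    by (subst sum.swap) (simp add: signed_sum_def inner_sum_left)
  finally show ?thesis
    using n unfolding success_rate_def b_def by (simp add: field_simps)
qed

theorem proposition2:
  fixes n :: nat
    and \<rho> :: "(nat \<Rightarrow> nat) \<Rightarrow> complex^2^2"
    and E :: "nat \<Rightarrow> nat \<Rightarrow> complex^2^2"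
  assumes "n \<ge> 1"
    and "pom_realisation n \<rho> E"
    and "success_rate n \<rho> E = 1 / 2 * (1 + 1 / sqrt (real n))"
  shows "n < 4"
proof -
  have \<rho>: "\<And>x. x \<in> bitstrings n \<Longrightarrow> density_operator (\<rho> x)"
    and E: "\<And>y. y \<in> {1..n} \<Longrightarrow> two_outcome_povm (E y)"
    using assms(2) by (auto simp: pom_realisation_def)
  let ?S = "\<Sum>x\<in>bitstrings n. signed_sum n (\<lambda>y. bloch (E y 0)) x \<bullet> bloch (\<rho> x)"
  \<comment> \<open>The optimal rate is exactly the value of \<open>?S\<close> that the dimension
    bound for signed sums requires.\<close>
  have "1 / (2 ^ n * n) * ?S = 1 / sqrt n"
    using assms(3) success_rate_bloch[OF assms(1) \<rho> E] by simp
  then have "?S = 2 ^ n * (real n / sqrt n)"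
    using assms(1) by (simp add: field_simps)
  then have "?S = 2 ^ n * sqrt n"
    by (simp add: real_div_sqrt)
  moreover have "norm (bloch (\<rho> x)) \<le> 1" if "x \<in> bitstrings n" for x
    using \<rho>[OF that] norm_bloch_le_trace[of "\<rho> x"] by (simp add: density_operator_def)
  ultimately have "n \<le> DIM(real^3)"
    using two_outcome_povm_bloch(3)[OF E] by (intro maximal_signed_correlation_dim) auto
  then show ?thesis
    by simp
qed

end
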